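(* Let $\tau$ be an ideal triangulation equipped with a taut angle structure that is both veering and transverse-taut. Then $\tau$ comes with at least two "exotic" taut angle structures, distinct from the given one (and usually not veering).
   Context: Ideal triangulations. $\overline{M}$ is a compact oriented 3-manifold whose boundary is a nonempty union of tori, decomposed into finitely many truncated tetrahedra $\Delta_1,\dots,\Delta_n$ glued in pairs along all their hexagonal faces. The boundary triangles obtained by truncating the tips remain unglued and give a (possibly non-simplicial) triangulation of $\partial\overline{M}$. Then $\tau=\{\Delta_1,\dots,\Delta_n\}$ is an ideal triangulation of $M=\overline{M}\smallsetminus\partial\overline{M}$. Edges of $M$ are the interior edges (not contained in $\partial\overline{M}$). Angle structures. Assign a real variable $\theta_j$ to every pair of opposite edges of every tetrahedron, so that $\Delta_i$ has angles $\theta_{3i-2},\theta_{3i-1},\theta_{3i}$. Impose: (1) these three angles sum to $\pi$ for each $i$; (2) for each edge of $M$, the angles around it (with multiplicity) sum to $2\pi$. A taut angle structure is a vector in $\{0,\pi\}^{3n}$ satisfying (1) and (2). Each corner of a boundary triangle carries the angle of the tetrahedron edge it truncates. Transverse-taut. A taut angle structure is transverse-taut if there is a transverse orientation on all the faces of the triangulation such that, for each tetrahedron, the two faces sharing one $\pi$-angle edge have it pointing inward, and the two faces sharing the other $\pi$-angle edge have it pointing outward. Veering. Given a taut angle structure, every boundary triangle has angles $(0,0,\pi)$, and the link of every vertex $v$ of $\partial\overline{M}$ consists of two $\pi$-angles separated by two (possibly empty) sequences of $0$-angles, the two fans of $v$. The structure is veering if for every vertex $v$, either all triangles of the two fans of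 $v$ have their $\pi$-angle immediately before $v$ in the counterclockwise cyclic order on the vertices of the triangle, or all of them have it immediately after $v$ ($\partial\overline{M}$ is oriented by the orientation of $M$). Terminology. "Exotic" is an informal name for the taut angle structures on $\tau$ asserted to exist, which are distinct from the given one; "usually" is likewise informal, and is not quantified. *)

theory Defs
  imports "HOL-Analysis.Analysis" "HOL-Combinatorics.Permutations"
begin

section \<open>Labelled tetrahedra and face gluings\<close>

datatype vert = V0 | V1 | V2 | V3

lemma UNIV_vert: "UNIV = {V0, V1, V2, V3}"
  using vert.exhaust by blast

instance vert :: finite
  by standard (simp add: UNIV_vert)

text \<open>
  The type \<open>'t\<close> indexes the tetrahedra.  Face \<open>f\<close> of a tetrahedron is the face opposite the
  vertex \<open>f\<close>.  Face \<open>f\<close> of \<open>t\<close> is glued to a face of \<open>nbr G t f\<close>; the map \<open>perm G t f\<close> sends each of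
  the three vertices of the face to the vertex it is identified with, and sends \<open>f\<close> to the name of
  the target face.
\<close>

type_synonym 't gluing = "'t \<Rightarrow> vert \<Rightarrow> 't \<times> (vert \<Rightarrow> vert)"

definition nbr :: "'t gluing \<Rightarrow> 't \<Rightarrow> vert \<Rightarrow> 't" where
  "nbr G t f = fst (G t f)"

definition perm :: "'t gluing \<Rightarrow> 't \<Rightarrow> vert \<Rightarrow> vert \<Rightarrow> vert" where
  "perm G t f = snd (G t f)"

text \<open>
  Each tetrahedron is oriented by its labelling, the labels \<open>V0, V1, V2, V3\<close> being taken in the same
  handedness throughout.  In an oriented manifold the gluings reverse the induced orientations of
  the faces, which for \<open>perm G t f\<close> (taking the vertex off one face to the vertex off the other)
  means being an odd permutation.  The second line says that faces are glued in pairs, the third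
  that no face is glued to itself.
\<close>

definition oriented_gluing :: "'t gluing \<Rightarrow> bool" where
  "oriented_gluing G \<longleftrightarrow> (\<forall>t f.
     bij (perm G t f) \<and> sign (perm G t f) = -1 \<and>
     G (nbr G t f) (perm G t f f) = (t, inv (perm G t f)) \<and>
     (nbr G t f, perm G t f f) \<noteq> (t, f))"


section \<open>The manifold with boundary and its boundary tori\<close>

text \<open>
  A truncated tetrahedron in barycentric coordinates: the hexagonal face \<open>f\<close> is where \<open>x f = 0\<close> and
  the boundary triangle at the tip \<open>v\<close> is where \<open>x v = 3/4\<close>.  Any truncation level strictly between
  \<open>1/2\<close> and \<open>1\<close> gives disjoint boundary triangles.
\<close>

definition trunc_tet :: "(vert \<Rightarrow> real) set" where
  "trunc_tet = {x. (\<forall>v. 0 \<le> x v \<and> x v \<le> 3/4) \<and> (\<Sum>v\<in>UNIV. x v) = 1}"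

definition tet_union :: "('t \<times> (vert \<Rightarrow> real)) topology" where
  "tet_union = prod_topology (discrete_topology UNIV) (top_of_set trunc_tet)"

definition glued_points :: "'t gluing \<Rightarrow> (('t \<times> (vert \<Rightarrow> real)) \<times> ('t \<times> (vert \<Rightarrow> real))) set" where
  "glued_points G =
     {((t, x), (nbr G t f, x \<circ> inv (perm G t f))) | t x f. x \<in> trunc_tet \<and> x f = 0}"

text \<open>For an oriented gluing the relation \<open>glued_points G\<close> is symmetric, so its reflexive transitive
  closure is an equivalence relation; likewise for \<open>edge_step\<close> and \<open>corner_step\<close> below.\<close>

definition glue_class :: "'t gluing \<Rightarrow> 't \<times> (vert \<Rightarrow> real) \<Rightarrow> ('t \<times> (vert \<Rightarrow> real)) set" where
  "glue_class G c = (glued_points G)\<^sup>* `` {c}"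

definition Mbar :: "'t gluing \<Rightarrow> ('t \<times> (vert \<Rightarrow> real)) set topology" where
  "Mbar G = topology (\<lambda>U. U \<subseteq> glue_class G ` topspace tet_union \<and>
     openin tet_union {c \<in> topspace tet_union. glue_class G c \<in> U})"

lemma quotient_map_glue_class: "quotient_map tet_union (Mbar G) (glue_class G)"
proof -
  let ?T = "tet_union :: ('a \<times> (vert \<Rightarrow> real)) topology"
  let ?P = "\<lambda>U. U \<subseteq> glue_class G ` topspace ?T \<and>
     openin ?T {c \<in> topspace ?T. glue_class G c \<in> U}"
  have "istopology ?P"
    unfolding istopology_def
  proof (intro conjI allI impI)
    fix S U assume S: "?P S" and U: "?P U"
    show "S \<inter> U \<subseteq> glue_class G ` topspace ?T" using S by blast
    have "{c \<in> topspace ?T. glue_class G c \<in> S \<inter> U} =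
        {c \<in> topspace ?T. glue_class G c \<in> S} \<inter> {c \<in> topspace ?T. glue_class G c \<in> U}"
      by blast
    then show "openin ?T {c \<in> topspace ?T. glue_class G c \<in> S \<inter> U}"
      using S U by auto
  next
    fix K assume K: "\<forall>S\<in>K. ?P S"
    show "\<Union>K \<subseteq> glue_class G ` topspace ?T" using K by blast
    have "{c \<in> topspace ?T. glue_class G c \<in> \<Union>K} =
        (\<Union>S\<in>K. {c \<in> topspace ?T. glue_class G c \<in> S})"
      by blast
    moreover have "openin ?T (\<Union>S\<in>K. {c \<in> topspace ?T. glue_class G c \<in> S})"
      using K by (intro openin_Union) blast
    ultimately show "openin ?T {c \<in> topspace ?T. glue_class G c \<in> \<Union>K}"
      by simp
  qed
  then have op: "openin (Mbar G) U \<longleftrightarrow> ?P U" for U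
    unfolding Mbar_def by (simp add: topology_inverse')
  have "topspace (Mbar G) = glue_class G ` topspace ?T"
  proof (rule antisym)
    show "topspace (Mbar G) \<subseteq> glue_class G ` topspace ?T"
      using op openin_topspace by blast
    have "{c \<in> topspace ?T. glue_class G c \<in> glue_class G ` topspace ?T} = topspace ?T" by blast
    then have "openin (Mbar G) (glue_class G ` topspace ?T)" using op by simp
    then show "glue_class G ` topspace ?T \<subseteq> topspace (Mbar G)" by (rule openin_subset)
  qed
  then show ?thesis
    unfolding quotient_map_def using op by auto
qed

definition boundary_Mbar :: "'t gluing \<Rightarrow> ('t \<times> (vert \<Rightarrow> real)) set set" where
  "boundary_Mbar G = glue_class G ` {(t, x). x \<in> trunc_tet \<and> (\<exists>v. x v = 3/4)}"

definition torus :: "(complex \<times> complex) topology" where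
  "torus = prod_topology (top_of_set (sphere 0 1)) (top_of_set (sphere 0 1))"

definition torus_boundary :: "'t gluing \<Rightarrow> bool" where
  "torus_boundary G \<longleftrightarrow>
     (\<forall>C \<in> connected_components_of (subtopology (Mbar G) (boundary_Mbar G)).
        subtopology (Mbar G) C homeomorphic_space torus)"

text \<open>
  No further condition is needed for \<open>Mbar G\<close> to be a compact oriented 3-manifold with boundary
  \<open>boundary_Mbar G\<close>: in an oriented gluing without self-glued faces no edge is identified with itself
  reversed.  The boundary is nonempty because types are.
\<close>

definition ideal_triangulation :: "('t::finite) gluing \<Rightarrow> bool" where
  "ideal_triangulation G \<longleftrightarrow> oriented_gluing G \<and> torus_boundary G"


section \<open>Angle structures\<close>

datatype opp_pair = P01_23 | P02_13 | P03_12

definition pair_of :: "vert set \<Rightarrow> opp_pair" where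
  "pair_of e = (if e \<in> {{V0, V1}, {V2, V3}} then P01_23
                else if e \<in> {{V0, V2}, {V1, V3}} then P02_13
                else P03_12)"

definition edge_angle :: "('t \<Rightarrow> opp_pair \<Rightarrow> real) \<Rightarrow> 't \<Rightarrow> vert set \<Rightarrow> real" where
  "edge_angle \<theta> t e = \<theta> t (pair_of e)"

text \<open>Edges of \<open>M\<close> are represented as classes of tetrahedron edges.  No tetrahedron edge is met twice
  when turning around an edge of \<open>M\<close>, so summing over the class counts multiplicities correctly.\<close>

definition edge_step :: "'t gluing \<Rightarrow> (('t \<times> vert set) \<times> ('t \<times> vert set)) set" where
  "edge_step G = {((t, e), (nbr G t f, perm G t f ` e)) | t e f. card e = 2 \<and> f \<notin> e}"

definition edge_class :: "'t gluing \<Rightarrow> 't \<times> vert set \<Rightarrow> ('t \<times> vert set) set" where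
  "edge_class G x = (edge_step G)\<^sup>* `` {x}"

definition angle_structure :: "('t::finite) gluing \<Rightarrow> ('t \<Rightarrow> opp_pair \<Rightarrow> real) \<Rightarrow> bool" where
  "angle_structure G \<theta> \<longleftrightarrow>
     (\<forall>t. \<theta> t P01_23 + \<theta> t P02_13 + \<theta> t P03_12 = pi) \<and>
     (\<forall>t e. card e = 2 \<longrightarrow> (\<Sum>(t', e') \<in> edge_class G (t, e). edge_angle \<theta> t' e') = 2 * pi)"

definition taut :: "('t::finite) gluing \<Rightarrow> ('t \<Rightarrow> opp_pair \<Rightarrow> real) \<Rightarrow> bool" where
  "taut G \<theta> \<longleftrightarrow> angle_structure G \<theta> \<and> (\<forall>t q. \<theta> t q \<in> {0, pi})"


section \<open>Transverse-taut structures\<close>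

text \<open>
  \<open>inward t f\<close> says that the transverse orientation of face \<open>f\<close> of \<open>t\<close> points into \<open>t\<close>.  The two faces
  sharing the edge \<open>e\<close> are those with \<open>f \<notin> e\<close>, and the two faces sharing the opposite edge are those
  with \<open>f \<in> e\<close>.
\<close>

definition transverse_orientation :: "'t gluing \<Rightarrow> ('t \<Rightarrow> vert \<Rightarrow> bool) \<Rightarrow> bool" where
  "transverse_orientation G inward \<longleftrightarrow>
     (\<forall>t f. inward (nbr G t f) (perm G t f f) \<longleftrightarrow> \<not> inward t f)"

definition transverse_taut :: "('t::finite) gluing \<Rightarrow> ('t \<Rightarrow> opp_pair \<Rightarrow> real) \<Rightarrow> bool" where
  "transverse_taut G \<theta> \<longleftrightarrow> taut G \<theta> \<and>
     (\<exists>inward. transverse_orientation G inward \<and>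
        (\<forall>t. \<exists>e. card e = 2 \<and> edge_angle \<theta> t e = pi \<and>
           (\<forall>f. f \<notin> e \<longrightarrow> inward t f) \<and> (\<forall>f. f \<in> e \<longrightarrow> \<not> inward t f)))"


section \<open>Veering structures\<close>

text \<open>
  The boundary triangle at the tip \<open>v\<close> of a tetrahedron has one corner for each \<open>a \<noteq> v\<close>, on the edge
  joining \<open>v\<close> to \<open>a\<close>; the corner after it in counterclockwise order is \<open>ccw v a\<close>.  The table is fixed
  by requiring that \<open>v, a, ccw v a\<close> followed by the fourth vertex be an even permutation of
  \<open>V0, V1, V2, V3\<close>.  Which handedness of the labels makes this literally counterclockwise is
  immaterial: the mirror choice exchanges the two alternatives in \<open>veering\<close>.
\<close>

fun ccw :: "vert \<Rightarrow> vert \<Rightarrow> vert" where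
  "ccw V0 V1 = V2" | "ccw V0 V2 = V3" | "ccw V0 V3 = V1"
| "ccw V1 V0 = V3" | "ccw V1 V3 = V2" | "ccw V1 V2 = V0"
| "ccw V2 V0 = V1" | "ccw V2 V1 = V3" | "ccw V2 V3 = V0"
| "ccw V3 V0 = V2" | "ccw V3 V2 = V1" | "ccw V3 V1 = V0"

text \<open>Transpositions of the labels, hence all odd permutations, reverse the cyclic orders.\<close>

lemma ccw_transpose:
  assumes "x \<noteq> y" "a \<noteq> v"
  shows "ccw (Transposition.transpose x y v) (Transposition.transpose x y (ccw v a)) =
    Transposition.transpose x y a"
  using assms by (cases x; cases y; cases a; cases v) (simp_all add: Transposition.transpose_def)

text \<open>Vertices of the boundary triangulation are represented as classes of corners \<open>(t, v, a)\<close>.\<close>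

definition corner_step :: "'t gluing \<Rightarrow> (('t \<times> vert \<times> vert) \<times> ('t \<times> vert \<times> vert)) set" where
  "corner_step G = {((t, v, a), (nbr G t f, perm G t f v, perm G t f a)) | t v a f.
     v \<noteq> a \<and> f \<noteq> v \<and> f \<noteq> a}"

definition corner_class :: "'t gluing \<Rightarrow> 't \<times> vert \<times> vert \<Rightarrow> ('t \<times> vert \<times> vert) set" where
  "corner_class G x = (corner_step G)\<^sup>* `` {x}"

definition corner_angle :: "('t \<Rightarrow> opp_pair \<Rightarrow> real) \<Rightarrow> 't \<Rightarrow> vert \<Rightarrow> vert \<Rightarrow> real" where
  "corner_angle \<theta> t v a = edge_angle \<theta> t {v, a}"

text \<open>The corners of the two fans of a boundary vertex are the corners in its class with angle \<open>0\<close>.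
  The \<open>\<pi>\<close>-angle of their triangle is immediately before, resp. after, the corner.\<close>

definition fans :: "'t gluing \<Rightarrow> ('t \<Rightarrow> opp_pair \<Rightarrow> real) \<Rightarrow> 't \<times> vert \<times> vert \<Rightarrow>
    ('t \<times> vert \<times> vert) set" where
  "fans G \<theta> x = {(t, v, a) \<in> corner_class G x. corner_angle \<theta> t v a = 0}"

definition veering :: "('t::finite) gluing \<Rightarrow> ('t \<Rightarrow> opp_pair \<Rightarrow> real) \<Rightarrow> bool" where
  "veering G \<theta> \<longleftrightarrow> taut G \<theta> \<and>
     (\<forall>t0 v0 a0. v0 \<noteq> a0 \<longrightarrow>
        (\<forall>(t, v, a) \<in> fans G \<theta> (t0, v0, a0).
           \<exists>b. b \<noteq> v \<and> ccw v b = a \<and> corner_angle \<theta> t v b = pi) \<or>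
        (\<forall>(t, v, a) \<in> fans G \<theta> (t0, v0, a0).
           corner_angle \<theta> t v (ccw v a) = pi))"

end

theory Submission
  imports Defs
begin

text \<open>
  A compatible coorientation of the faces gives every tetrahedron two upper and two lower faces; its
  two \<open>\<pi>\<close>-edges are the top edge, where the upper faces meet, and the bottom edge, where the lower
  faces meet.  Going around an edge of \<open>M\<close> one meets one tetrahedron below it (having it as top
  edge), one tetrahedron above it (having it as bottom edge), and two fans of tetrahedra having it as
  a \<open>0\<close>-edge.  Being veering means that the edges of \<open>M\<close> carry two colours such that the
  \<open>0\<close>-edges of each tetrahedron, which form a quadrilateral, alternate in colour; opposite
  \<open>0\<close>-edges have the same colour.

  In this situation a tetrahedron is the lowest one of the fan of its \<open>0\<close>-edge \<open>e\<close> if and only if its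
  bottom edge has the colour of \<open>e\<close>.  So in every tetrahedron exactly one pair of opposite edges,
  the pair of \<open>0\<close>-edges with the colour of the bottom edge, consists of fan starts
  (\<open>fan_start_opposite\<close>, \<open>fan_start_one_pair\<close>).  Every fan is nonempty, so every edge of \<open>M\<close> has
  exactly two fan starts, which lie on the two upper faces of the tetrahedron below the edge
  (\<open>two_fan_starts\<close>).  Hence moving the angle \<open>\<pi>\<close> to the fan starts gives a taut structure.
  Reversing the coorientation gives a second one, supported on the fan ends.

  Both are supported on edges that had angle \<open>0\<close>, so they differ from the given structure.  They also
  differ from each other (\<open>fan_starts_differ\<close>).  Otherwise fan starts and fan ends coincide.
  Each tetrahedron has \<open>0\<close>-edges that are not fan starts; starting from one of them and turning
  around the edge in either direction, one never leaves a fan, because a fan could only be left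
  through a fan start or a fan end.  Such an edge of \<open>M\<close> would have no angle \<open>\<pi>\<close> at all.

  Fan starts are defined by looking across a single lower face, which makes every argument local: the
  global colouring enters only through \<open>nonflat_across\<close> (on the two sides of one face) and
  \<open>flat_two_sides\<close> (on the two sides of one tetrahedron).
\<close>

section \<open>Cyclic orders and odd permutations of the labels\<close>

lemma ccw_frame:
  assumes "v \<noteq> a"
  shows "distinct [v, a, ccw v a, ccw v (ccw v a)]"
    and "ccw v (ccw v (ccw v a)) = a"
    and "ccw a v = ccw v (ccw v a)"
  using assms by (cases v; cases a; simp)+

lemma distinct_vert_UNIV:
  fixes a b c d :: vert
  assumes "distinct [a, b, c, d]"
  shows "UNIV = {a, b, c, d}"
  using assms by (cases a; cases b; cases c; cases d; auto simp: UNIV_vert)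

lemma ccw_cases:
  assumes "distinct [v, a, c, d]"
  obtains "ccw v a = c" "ccw v c = d" "ccw v d = a"
        | "ccw v a = d" "ccw v d = c" "ccw v c = a"
  using assms by (cases v; cases a; cases c; cases d; simp)

lemma edge_frame:
  assumes "card (e :: vert set) = 2"
  obtains a b c d where "e = {a, b}" "- e = {c, d}" "distinct [a, b, c, d]"
proof -
  from assms obtain a b where e: "e = {a, b}" "a \<noteq> b" by (auto simp: card_2_iff)
  have d: "distinct [a, b, ccw a b, ccw a (ccw a b)]" by (rule ccw_frame(1)[OF e(2)])
  have "- e = {ccw a b, ccw a (ccw a b)}" using distinct_vert_UNIV[OF d] d e by auto
  with e d show thesis using that by blast
qed

lemma card_Compl_edge: "card e = 2 \<Longrightarrow> card (- e) = 2" for e :: "vert set"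
  by (erule edge_frame) simp

lemma pair_of_eq_iff:
  assumes "card e = 2" "card e' = 2"
  shows "pair_of e = pair_of e' \<longleftrightarrow> e' = e \<or> e' = - e"
proof -
  have c: "- {V0, V1} = {V2, V3}" "- {V2, V3} = {V0, V1}" "- {V0, V2} = {V1, V3}"
    "- {V1, V3} = {V0, V2}" "- {V0, V3} = {V1, V2}" "- {V1, V2} = {V0, V3}"
    using UNIV_vert by auto
  have s: "e \<in> {{V0, V1}, {V2, V3}, {V0, V2}, {V1, V3}, {V0, V3}, {V1, V2}}"
    if "card e = 2" for e
  proof -
    from that obtain x y where "e = {x, y}" "x \<noteq> y" by (auto simp: card_2_iff)
    then show ?thesis by (cases x; cases y) (simp_all add: insert_commute)
  qed
  show ?thesis using s[OF assms(1)] s[OF assms(2)] unfolding insert_iff empty_iff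
    by (elim disjE; simp add: pair_of_def c doubleton_eq_iff)
qed

text \<open>Even permutations preserve the cyclic orders and odd ones reverse them.  Both parities are
  treated together because composing with a transposition exchanges them.\<close>

lemma ccw_permutation:
  assumes "p permutes (UNIV :: vert set)" "v \<noteq> a"
  shows "if sign p = 1 then ccw (p v) (p a) = p (ccw v a) else ccw (p v) (p (ccw v a)) = p a"
proof -
  have "finite (UNIV :: vert set)" by simp
  with assms(1)
  have "\<forall>v a. v \<noteq> a \<longrightarrow>
      (if sign p = 1 then ccw (p v) (p a) = p (ccw v a) else ccw (p v) (p (ccw v a)) = p a)"
  proof (induction rule: permutes_induct)
    case id
    then show ?case by simp
  next
    case (swap x y p)
    have sg: "sign (Transposition.transpose x y \<circ> p) = - sign p"
      using swap by (simp add: sign_compose permutation_swap_id permutes_imp_permutation sign_swap_id)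
    have inj: "inj p" using swap by (simp add: permutes_inj)
    show ?case
    proof (intro allI impI)
      fix v a :: vert assume va: "v \<noteq> a"
      then have "ccw v a \<noteq> v" using ccw_frame(1) by fastforce
      then have "p (ccw v a) \<noteq> p v" "p a \<noteq> p v" using inj va by (auto simp: inj_eq)
      then show "if sign (Transposition.transpose x y \<circ> p) = 1
        then ccw ((Transposition.transpose x y \<circ> p) v) ((Transposition.transpose x y \<circ> p) a)
          = (Transposition.transpose x y \<circ> p) (ccw v a)
        else ccw ((Transposition.transpose x y \<circ> p) v) ((Transposition.transpose x y \<circ> p) (ccw v a))
          = (Transposition.transpose x y \<circ> p) a"
        using swap.IH swap.hyps va ccw_transpose[of x y _ "p v"] sg
        by (auto simp: sign_def split: if_splits) metis+
    qed
  qed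
  then show ?thesis using assms(2) by blast
qed

lemma ccw_odd:
  fixes p :: "vert \<Rightarrow> vert"
  assumes "bij p" "sign p = -1" "v \<noteq> a"
  shows "ccw (p v) (p (ccw v a)) = p a"
proof -
  have "p permutes UNIV" using assms(1) by (intro bij_imp_permutes) auto
  from ccw_permutation[OF this assms(3)] show ?thesis using assms(2) by simp
qed

lemma card_perm_image:
  assumes "oriented_gluing G"
  shows "card (perm G t f ` e) = card e"
  using assms by (intro card_image inj_on_subset[OF bij_is_inj]) (auto simp: oriented_gluing_def)

lemma card_edge_class:
  assumes "oriented_gluing G" "(t, e) \<in> edge_class G (t0, e0)" "card e0 = 2"
  shows "card e = 2"
proof -
  have "((t0, e0), (t, e)) \<in> (edge_step G)\<^sup>*" using assms(2) by (simp add: edge_class_def)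
  then show ?thesis
    using assms(3)
    by (induction rule: rtrancl_induct2) (auto simp: edge_step_def card_perm_image[OF assms(1)])
qed

section \<open>Coorientations of veering type\<close>

text \<open>
  The coorientation alone encodes the taut structure.  The label \<open>f\<close> names the face opposite to it,
  \<open>s t f\<close> says that this is a lower face of \<open>t\<close>, and \<open>{a, b}\<close> lies on the faces named by the other
  two labels.  So \<open>{a, b}\<close> is a \<open>\<pi>\<close>-edge iff \<open>s t a = s t b\<close>: it is the top edge if both labels name
  lower faces and the bottom edge if both name upper faces.  For a \<open>0\<close>-edge \<open>{v, a}\<close> the truth value of
  \<open>s t v = s t (ccw v a)\<close> is its colour.  All conditions are invariant under reversing the
  coorientation, so that everything proved about lower faces also holds for upper ones.
\<close>

locale veering_coorientation =
  fixes G :: "('t::finite) gluing" and s :: "'t \<Rightarrow> vert \<Rightarrow> bool"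
  assumes oriented: "oriented_gluing G"
    and coorientation: "transverse_orientation G s"
    and balanced: "card {f. s t f} = 2"
    and veering_corners:
      "\<lbrakk>((t, v, a), (t', v', a')) \<in> (corner_step G)\<^sup>*; v \<noteq> a; s t v \<noteq> s t a; s t' v' \<noteq> s t' a'\<rbrakk>
       \<Longrightarrow> (s t v = s t (ccw v a)) = (s t' v' = s t' (ccw v' a'))"
    and two_flat: "card e = 2 \<Longrightarrow>
      card {(t', e') \<in> edge_class G (t, e). \<forall>a\<in>e'. \<forall>b\<in>e'. s t' a = s t' b} = 2"
begin

definition flat :: "'t \<Rightarrow> vert set \<Rightarrow> bool" where
  "flat t e \<longleftrightarrow> (\<forall>a\<in>e. \<forall>b\<in>e. s t a = s t b)"

text \<open>The tetrahedron \<open>t\<close> is the lowest one in a fan of \<open>e\<close>: the tetrahedron below the unique lower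
  face of \<open>t\<close> at \<open>e\<close> is outside the fan.\<close>

definition fan_start :: "'t \<Rightarrow> vert set \<Rightarrow> bool" where
  "fan_start t e \<longleftrightarrow> \<not> flat t e \<and>
     (\<exists>f. f \<notin> e \<and> s t f \<and> flat (nbr G t f) (perm G t f ` e))"

lemma flat_pair [simp]: "flat t {a, b} \<longleftrightarrow> s t a = s t b"
  by (auto simp: flat_def)

lemma perm_bij: "bij (perm G t f)"
  and perm_sign: "sign (perm G t f) = -1"
  and glue_back: "nbr G (nbr G t f) (perm G t f f) = t"
    "perm G (nbr G t f) (perm G t f f) = inv (perm G t f)"
  using oriented by (auto simp: oriented_gluing_def nbr_def perm_def)

lemma perm_eq_iff [simp]: "perm G t f a = perm G t f b \<longleftrightarrow> a = b"
  using perm_bij[of t f] by (metis bij_pointE)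

lemma inv_perm [simp]: "inv (perm G t f) (perm G t f a) = a"
  using perm_bij by (simp add: bij_is_inj)

lemma s_across: "s (nbr G t f) (perm G t f f) \<longleftrightarrow> \<not> s t f"
  using coorientation by (simp add: transverse_orientation_def)

text \<open>With two lower and two upper faces, each label agrees with exactly one of the other three.  The
  disjunctive form lets propositional reasoning replace counting.\<close>

lemma two_two:
  assumes "distinct [a, b, c, d]"
  shows "(s t b = s t a \<and> s t c \<noteq> s t a \<and> s t d \<noteq> s t a) \<or>
     (s t c = s t a \<and> s t b \<noteq> s t a \<and> s t d \<noteq> s t a) \<or>
     (s t d = s t a \<and> s t b \<noteq> s t a \<and> s t c \<noteq> s t a)"
proof -
  have "{f. s t f} = {f \<in> {a, b, c, d}. s t f}"
    using distinct_vert_UNIV[OF assms] by auto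
  also have "\<dots> = (if s t a then {a} else {}) \<union> (if s t b then {b} else {}) \<union>
      (if s t c then {c} else {}) \<union> (if s t d then {d} else {})" by auto
  finally have "card ((if s t a then {a} else {}) \<union> (if s t b then {b} else {}) \<union>
      (if s t c then {c} else {}) \<union> (if s t d then {d} else {})) = 2"
    using balanced[of t] by simp
  then show ?thesis using assms by (auto split: if_splits)
qed

lemma corner_across:
  assumes "v \<noteq> a" "f \<noteq> v" "f \<noteq> a"
  shows "((t, v, a), (nbr G t f, perm G t f v, perm G t f a)) \<in> corner_step G"
    and "((nbr G t f, perm G t f v, perm G t f a), (t, v, a)) \<in> corner_step G"
proof -
  show "((t, v, a), (nbr G t f, perm G t f v, perm G t f a)) \<in> corner_step G"
    using assms by (auto simp: corner_step_def)
  show "((nbr G t f, perm G t f v, perm G t f a), (t, v, a)) \<in> corner_step G"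
    unfolding corner_step_def
    using assms glue_back[of t f]
    by (intro CollectI exI[of _ "nbr G t f"] exI[of _ "perm G t f v"] exI[of _ "perm G t f a"]
        exI[of _ "perm G t f f"]) simp
qed

lemma ccw_across:
  assumes "v \<noteq> a"
  shows "ccw (perm G t f v) (perm G t f (ccw v a)) = perm G t f a"
  using ccw_odd[OF perm_bij perm_sign assms] .

lemma distinct_perm:
  "distinct [v, a, c, d] \<Longrightarrow>
    distinct [perm G t f v, perm G t f a, perm G t f c, perm G t f d]"
  by simp

text \<open>
  This is the form in which the veering condition is used.  Suppose that \<open>{v, a}\<close> is a \<open>0\<close>-edge on
  both sides of the face \<open>f\<close>.  The gluing reverses the cyclic order, so the label following \<open>a\<close>
  around \<open>v\<close> is the one opposite the face on exactly one of the two sides; and the coorientation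
  attached to the label opposite the face changes across it.  The two changes cancel, so equality of
  colours says that the coorientation attached to \<open>v\<close> is the same on both sides.
\<close>

lemma nonflat_across:
  assumes d: "distinct [v, a, f, d]"
    and 1: "s t v \<noteq> s t a"
    and 2: "s (nbr G t f) (perm G t f v) \<noteq> s (nbr G t f) (perm G t f a)"
  shows "s (nbr G t f) (perm G t f v) = s t v"
proof -
  let ?p = "perm G t f" and ?t = "nbr G t f"
  have V: "(s t v = s t (ccw v a)) = (s ?t (?p v) = s ?t (ccw (?p v) (?p a)))"
    using veering_corners[OF r_into_rtrancl[OF corner_across(1)], of v a f t] d 1 2 by auto
  note b = two_two[OF d, of t] two_two[OF distinct_perm[OF d], of ?t t f] s_across[of t f]
  show ?thesis
    using d
  proof (cases rule: ccw_cases)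
    case 1
    then have "ccw (?p v) (?p a) = ?p d" using ccw_across[of v d t f] d by auto
    then show ?thesis using V b 1 assms(2) 2 by auto
  next
    case 2
    then have "ccw (?p v) (?p a) = ?p f" using ccw_across[of v f t f] d by auto
    then show ?thesis using V b 2 assms(2,3) by auto
  qed
qed

text \<open>
  The colour of a \<open>\<pi>\<close>-edge \<open>{u, w}\<close> is not visible in its tetrahedron \<open>t\<close>, but it is visible in the
  neighbours across the two faces at \<open>{u, w}\<close>.  As both see the same colour from opposite sides of the
  edge, they attach opposite coorientations to \<open>u\<close>.
\<close>

lemma flat_two_sides:
  assumes d: "distinct [u, w, c, d]"
    and fl: "s t u = s t w"
    and 1: "s (nbr G t c) (perm G t c u) \<noteq> s (nbr G t c) (perm G t c w)"
    and 2: "s (nbr G t d) (perm G t d u) \<noteq> s (nbr G t d) (perm G t d w)"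
  shows "s (nbr G t c) (perm G t c u) \<noteq> s (nbr G t d) (perm G t d u)"
proof -
  let ?p = "perm G t c" and ?t = "nbr G t c" and ?q = "perm G t d" and ?t' = "nbr G t d"
  have "((?t, ?p u, ?p w), (?t', ?q u, ?q w)) \<in> (corner_step G)\<^sup>*"
    using corner_across(2)[of u w c t] corner_across(1)[of u w d t] d
    by (auto intro: converse_rtrancl_into_rtrancl)
  then have V: "(s ?t (?p u) = s ?t (ccw (?p u) (?p w))) = (s ?t' (?q u) = s ?t' (ccw (?q u) (?q w)))"
    using veering_corners 1 2 d by fastforce
  note b = two_two[OF d, of t] two_two[OF distinct_perm[OF d], of ?t t c]
    two_two[OF distinct_perm[OF d], of ?t' t d] s_across[of t c] s_across[of t d]
  show ?thesis
    using d
  proof (cases rule: ccw_cases)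
    case c: 1
    then have "ccw (?p u) (?p w) = ?p d" "ccw (?q u) (?q w) = ?q d"
      using ccw_across[of u d t] d by auto
    then show ?thesis using V b fl 1 2 by auto
  next
    case c: 2
    then have "ccw (?p u) (?p w) = ?p c" "ccw (?q u) (?q w) = ?q c"
      using ccw_across[of u c t] d by auto
    then show ?thesis using V b fl 1 2 by auto
  qed
qed

text \<open>
  The fans are nonempty.  If \<open>{u, w}\<close> had angle \<open>\<pi>\<close> on both sides of the face \<open>f\<close>, then the third vertex
  \<open>a\<close> of the face would be its odd one out on both sides, and \<open>{a, u}\<close> would be a \<open>0\<close>-edge on both sides
  at which the coorientation attached to \<open>a\<close> changes with that of \<open>f\<close>.
\<close>

lemma flat_not_across:
  assumes d: "distinct [u, w, f, a]" and fl: "s t u = s t w"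
  shows "s (nbr G t f) (perm G t f u) \<noteq> s (nbr G t f) (perm G t f w)"
proof
  assume fl': "s (nbr G t f) (perm G t f u) = s (nbr G t f) (perm G t f w)"
  have d': "distinct [a, u, f, w]" using d by auto
  note b = two_two[OF d', of t] two_two[OF distinct_perm[OF d'], of "nbr G t f" t f] s_across[of t f]
  show False
    using nonflat_across[OF d', of t] b fl fl' by auto
qed

section \<open>The taut structure of fan starts\<close>

lemma fan_start_face:
  assumes d: "distinct [x, y, f, d]" and "s t f" "s t x \<noteq> s t y"
  shows "fan_start t {x, y} \<longleftrightarrow> s (nbr G t f) (perm G t f x) = s (nbr G t f) (perm G t f y)"
proof -
  have "\<not> s t d" using two_two[OF d, of t] assms by auto
  then have f: "(g \<notin> {x, y} \<and> s t g) = (g = f)" for g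
    using distinct_vert_UNIV[OF d] assms(1,2) by auto
  have "fan_start t {x, y} \<longleftrightarrow> \<not> flat t {x, y} \<and> flat (nbr G t f) (perm G t f ` {x, y})"
    by (simp only: fan_start_def conj_assoc[symmetric] f simp_thms)
  then show ?thesis using assms(3) by simp
qed

text \<open>Seen from below the lower face \<open>f\<close>, exactly one of its three edges has angle \<open>\<pi>\<close>.  It is not the
  bottom edge \<open>{u, w}\<close> of \<open>t\<close>, so it is one of the two \<open>0\<close>-edges of the face.\<close>

lemma fan_start_one_per_face:
  assumes d: "distinct [x, f, u, w]" and x: "s t x" and f: "s t f"
  shows "fan_start t {x, u} \<noteq> fan_start t {x, w}"
proof -
  have u: "\<not> s t u" and w: "\<not> s t w" using two_two[OF d, of t] x f by blast+
  then have uw: "s t u = s t w" by simp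
  have xu: "s t x \<noteq> s t u" and xw: "s t x \<noteq> s t w" using x u w by simp_all
  have d': "distinct [x, u, f, w]" "distinct [x, w, f, u]" "distinct [u, w, f, x]" using d by auto
  show ?thesis
    unfolding fan_start_face[OF d'(1) f xu] fan_start_face[OF d'(2) f xw]
    using flat_not_across[OF d'(3) uw] by blast
qed

text \<open>The edges \<open>{x, u}\<close> and \<open>{f, w}\<close> lie on the two lower faces \<open>f\<close> and \<open>x\<close>.  Which of the two
  \<open>0\<close>-edges of a lower face is a fan start depends on the colour of the bottom edge \<open>{u, w}\<close>, as seen
  through that face; both faces see the same colour.\<close>

lemma fan_start_opposite_aux:
  assumes d: "distinct [x, f, u, w]" and x: "s t x" and f: "s t f"
  shows "fan_start t {x, u} \<longleftrightarrow> fan_start t {f, w}"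
proof -
  let ?T = "s (nbr G t f)" and ?p = "perm G t f" and ?T' = "s (nbr G t x)" and ?q = "perm G t x"
  have u: "\<not> s t u" and w: "\<not> s t w" using two_two[OF d, of t] x f by blast+
  then have uw: "s t u = s t w" by simp
  have xu: "s t x \<noteq> s t u" and fw: "s t f \<noteq> s t w" using x f u w by simp_all
  have d': "distinct [x, u, f, w]" "distinct [f, w, x, u]" "distinct [u, w, f, x]"
    "distinct [u, w, x, f]" using d by auto
  have p: "?T (?p u) \<noteq> ?T (?p w)" by (rule flat_not_across[OF d'(3) uw])
  have q: "?T' (?q u) \<noteq> ?T' (?q w)" by (rule flat_not_across[OF d'(4) uw])
  have pq: "?T (?p u) \<noteq> ?T' (?q u)" by (rule flat_two_sides[OF d'(3) uw p q])
  have px: "?T (?p x)"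
    using two_two[OF distinct_perm[OF d'(3)], of "nbr G t f" t f] s_across[of t f] p f by blast
  have qf: "?T' (?q f)"
    using two_two[OF distinct_perm[OF d'(4)], of "nbr G t x" t x] s_across[of t x] q x by blast
  show ?thesis
    unfolding fan_start_face[OF d'(1) f xu] fan_start_face[OF d'(2) x fw] using p q pq px qf by blast
qed

lemma fan_start_opposite:
  assumes d: "distinct [a, b, c, d]"
  shows "fan_start t {a, b} \<longleftrightarrow> fan_start t {c, d}"
proof (cases "s t a = s t b")
  case True
  then have "s t c = s t d" using two_two[OF d, of t] by blast
  with True show ?thesis by (simp add: fan_start_def)
next
  case False
  then consider "s t a" "s t c" | "s t a" "s t d" | "s t b" "s t c" | "s t b" "s t d"
    using two_two[OF d, of t] by blast
  then show ?thesis
  proof cases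
    case 1
    have "distinct [a, c, b, d]" using d by auto
    from fan_start_opposite_aux[OF this 1] show ?thesis .
  next
    case 2
    have "distinct [a, d, b, c]" using d by auto
    from fan_start_opposite_aux[OF this 2] show ?thesis by (simp add: insert_commute)
  next
    case 3
    have "distinct [b, c, a, d]" using d by auto
    from fan_start_opposite_aux[OF this 3] show ?thesis by (simp add: insert_commute)
  next
    case 4
    have "distinct [b, d, a, c]" using d by auto
    from fan_start_opposite_aux[OF this 4] show ?thesis by (simp add: insert_commute)
  qed
qed

lemma fan_start_one_pair:
  assumes d: "distinct [v, a, b, c]"
  shows "(fan_start t {v, a} \<and> \<not> fan_start t {v, b} \<and> \<not> fan_start t {v, c}) \<or>
    (\<not> fan_start t {v, a} \<and> fan_start t {v, b} \<and> \<not> fan_start t {v, c}) \<or>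
    (\<not> fan_start t {v, a} \<and> \<not> fan_start t {v, b} \<and> fan_start t {v, c})"
proof -
  have flat: "\<not> fan_start t {v, x}" if "s t v = s t x" for x
    using that by (simp add: fan_start_def)
  have *: "fan_start t {v, y} \<noteq> fan_start t {v, z}"
    if d: "distinct [v, x, y, z]" and e: "s t v = s t x" for x y z
  proof (cases "s t v")
    case True
    then show ?thesis using fan_start_one_per_face[OF d] e by simp
  next
    case False
    have d': "distinct [y, z, x, v]" "distinct [v, z, x, y]" using d by auto
    have "\<not> s t x" using False e by simp
    then have yz: "s t y" "s t z" using two_two[OF d, of t] False by blast+
    from fan_start_one_per_face[OF d'(1) yz] fan_start_opposite[OF d'(2), of t]
    show ?thesis by (simp add: insert_commute[of y])
  qed
  have d': "distinct [v, b, a, c]" "distinct [v, c, a, b]" using d by auto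
  consider "s t v = s t a" | "s t v = s t b" | "s t v = s t c" using two_two[OF d, of t] by blast
  then show ?thesis
  proof cases
    case 1
    from flat[OF this] *[OF d this] show ?thesis by blast
  next
    case 2
    from flat[OF this] *[OF d'(1) this] show ?thesis by blast
  next
    case 3
    from flat[OF this] *[OF d'(2) this] show ?thesis by blast
  qed
qed

lemma fan_start_iff:
  assumes "card e = 2" "\<not> flat t e" "f \<notin> e" "s t f"
  shows "fan_start t e \<longleftrightarrow> flat (nbr G t f) (perm G t f ` e)"
proof -
  obtain a b c d where e: "e = {a, b}" "- e = {c, d}" and d: "distinct [a, b, c, d]"
    by (rule edge_frame[OF assms(1)])
  have ab: "s t a \<noteq> s t b" using assms(2) e by simp
  have "f = c \<or> f = d" using assms(3) e by blast
  then obtain g where g: "distinct [a, b, f, g]" using d by auto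
  show ?thesis using fan_start_face[OF g assms(4) ab] e by simp
qed

lemma one_inward_face:
  assumes "card e = 2" "\<not> flat t e"
  shows "card {f. f \<notin> e \<and> s t f} = 1"
proof -
  obtain a b c d where e: "e = {a, b}" "- e = {c, d}" and d: "distinct [a, b, c, d]"
    by (rule edge_frame[OF assms(1)])
  have "s t a \<noteq> s t b" using assms(2) e by simp
  then have cd: "s t c \<noteq> s t d" using two_two[OF d, of t] by blast
  have "{f. f \<notin> e \<and> s t f} = {f \<in> - e. s t f}" by blast
  also have "\<dots> = (if s t c then {c} else {d})" using cd e(2) by auto
  finally show ?thesis by simp
qed

lemma flat_across_is_nonflat:
  assumes "card e = 2" "flat t e" "f \<notin> e"
  shows "\<not> flat (nbr G t f) (perm G t f ` e)"
proof -
  obtain a b c d where e: "e = {a, b}" "- e = {c, d}" and d: "distinct [a, b, c, d]"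
    by (rule edge_frame[OF assms(1)])
  have ab: "s t a = s t b" using assms(2) e by simp
  have "f = c \<or> f = d" using assms(3) e by blast
  then obtain g where g: "distinct [a, b, f, g]" using d by auto
  show ?thesis using flat_not_across[OF g ab] e by simp
qed

section \<open>Counting around an edge\<close>

text \<open>A flag is a tetrahedron edge together with one of the two faces at it.  Crossing the face is an
  involution on the flags at an edge of \<open>M\<close>, which yields bijections between kinds of flags without a
  choice of a direction of turning.\<close>

definition cross :: "('t \<times> vert set) \<times> vert \<Rightarrow> ('t \<times> vert set) \<times> vert" where
  "cross x = (case x of ((t, e), f) \<Rightarrow> ((nbr G t f, perm G t f ` e), perm G t f f))"

lemma cross_simp: "cross ((t, e), f) = ((nbr G t f, perm G t f ` e), perm G t f f)"
  by (simp add: cross_def)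

lemma cross_cross: "cross (cross x) = x"
proof -
  obtain t e f where x: "x = ((t, e), f)" by (metis surj_pair)
  have "inv (perm G t f) ` perm G t f ` e = e" by (simp add: image_image)
  then show ?thesis by (simp add: x cross_simp glue_back)
qed

lemma edge_class_card_2:
  "(t, e) \<in> edge_class G (t0, e0) \<Longrightarrow> card e0 = 2 \<Longrightarrow> card e = 2"
  by (rule card_edge_class[OF oriented])

lemma edge_class_across:
  assumes "(t, e) \<in> edge_class G x" "card e = 2" "f \<notin> e"
  shows "(nbr G t f, perm G t f ` e) \<in> edge_class G x"
proof -
  have "((t, e), (nbr G t f, perm G t f ` e)) \<in> edge_step G"
    using assms by (auto simp: edge_step_def)
  then show ?thesis using assms(1) by (auto simp: edge_class_def intro: rtrancl_into_rtrancl)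
qed

definition flags :: "'t \<times> vert set \<Rightarrow> (('t \<times> vert set) \<times> vert) set" where
  "flags x = (SIGMA y : edge_class G x. - snd y)"

lemma card_flags:
  "card {y \<in> flags x. P y} = (\<Sum>(t, e) \<in> edge_class G x. card {f. f \<notin> e \<and> P ((t, e), f)})"
proof -
  have "{y \<in> flags x. P y} = (SIGMA y : edge_class G x. {f. f \<notin> snd y \<and> P (y, f)})"
    by (auto simp: flags_def)
  then show ?thesis by (simp add: card_SigmaI case_prod_unfold)
qed

lemma cross_flags:
  assumes "card (snd x) = 2" "y \<in> flags x"
  shows "cross y \<in> flags x"
proof -
  obtain t e f where y: "y = ((t, e), f)" by (metis surj_pair)
  have te: "(t, e) \<in> edge_class G x" "f \<notin> e" using assms(2) by (auto simp: y flags_def)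
  have "card e = 2" using edge_class_card_2[of t e "fst x" "snd x"] te assms(1) by simp
  then show ?thesis using te edge_class_across[of t e x f] by (auto simp: y flags_def cross_simp)
qed

lemma card_flags_cross:
  assumes x: "card (snd x) = 2"
    and "\<And>y. y \<in> flags x \<Longrightarrow> P y \<Longrightarrow> Q (cross y)"
    and "\<And>y. y \<in> flags x \<Longrightarrow> Q y \<Longrightarrow> P (cross y)"
  shows "card {y \<in> flags x. P y} = card {y \<in> flags x. Q y}"
proof (rule bij_betw_same_card)
  show "bij_betw cross {y \<in> flags x. P y} {y \<in> flags x. Q y}"
    using assms(2,3) cross_flags[OF x] by (intro bij_betw_byWitness[where f' = cross]) (auto simp: cross_cross)
qed

definition top_edge :: "'t \<Rightarrow> vert set \<Rightarrow> bool" where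
  "top_edge t e \<longleftrightarrow> (\<forall>a\<in>e. s t a)"

definition bottom_edge :: "'t \<Rightarrow> vert set \<Rightarrow> bool" where
  "bottom_edge t e \<longleftrightarrow> (\<forall>a\<in>e. \<not> s t a)"

lemma flat_top_bottom:
  assumes "card e = 2"
  shows "flat t e \<longleftrightarrow> top_edge t e \<or> bottom_edge t e" "\<not> (top_edge t e \<and> bottom_edge t e)"
proof -
  obtain a b c d where e: "e = {a, b}" "- e = {c, d}" and d: "distinct [a, b, c, d]"
    by (rule edge_frame[OF assms(1)])
  show "flat t e \<longleftrightarrow> top_edge t e \<or> bottom_edge t e" "\<not> (top_edge t e \<and> bottom_edge t e)"
    by (cases "s t a"; cases "s t b"; simp add: e top_edge_def bottom_edge_def)+
qed

lemma faces_at_flat_edge: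
  assumes "card e = 2"
  shows "top_edge t e \<Longrightarrow> {f. f \<notin> e \<and> s t f} = {} \<and> {f. f \<notin> e \<and> \<not> s t f} = - e"
    and "bottom_edge t e \<Longrightarrow> {f. f \<notin> e \<and> s t f} = - e \<and> {f. f \<notin> e \<and> \<not> s t f} = {}"
proof -
  obtain a b c d where e: "e = {a, b}" "- e = {c, d}" and d: "distinct [a, b, c, d]"
    by (rule edge_frame[OF assms(1)])
  have *: "f \<notin> e \<longleftrightarrow> f \<in> {c, d}" for f using e(2) by blast
  {
    assume "top_edge t e"
    then have "s t a" "s t b" by (simp_all add: top_edge_def e)
    then have "\<not> s t c" "\<not> s t d" using two_two[OF d, of t] by blast+
    then show "{f. f \<notin> e \<and> s t f} = {} \<and> {f. f \<notin> e \<and> \<not> s t f} = - e"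
      unfolding * e(2) by auto
  next
    assume "bottom_edge t e"
    then have "\<not> s t a" "\<not> s t b" by (simp_all add: bottom_edge_def e)
    then have "s t c" "s t d" using two_two[OF d, of t] by blast+
    then show "{f. f \<notin> e \<and> s t f} = - e \<and> {f. f \<notin> e \<and> \<not> s t f} = {}"
      unfolding * e(2) by auto
  }
qed

lemma reverse: "veering_coorientation G (\<lambda>t f. \<not> s t f)"
proof
  show "oriented_gluing G" by (rule oriented)
  show "transverse_orientation G (\<lambda>t f. \<not> s t f)"
    using coorientation by (simp add: transverse_orientation_def)
  show "card {f. \<not> s t f} = 2" for t
    using card_Compl_edge[OF balanced[of t]] by (simp add: Collect_neg_eq)
  show "(\<not> s t v) = (\<not> s t (ccw v a)) \<longleftrightarrow> (\<not> s t' v') = (\<not> s t' (ccw v' a'))"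
    if "((t, v, a), (t', v', a')) \<in> (corner_step G)\<^sup>*" "v \<noteq> a"
      "(\<not> s t v) \<noteq> (\<not> s t a)" "(\<not> s t' v') \<noteq> (\<not> s t' a')" for t v a t' v' a'
    using veering_corners[OF that(1,2)] that(3,4) by blast
  show "card {(t', e') \<in> edge_class G (t, e). \<forall>a\<in>e'. \<forall>b\<in>e'. (\<not> s t' a) = (\<not> s t' b)} = 2"
    if "card e = 2" for t e
    using two_flat[OF that] by simp
qed

lemma one_outward_face:
  assumes "card e = 2" "\<not> flat t e"
  shows "card {f. f \<notin> e \<and> \<not> s t f} = 1"
proof -
  interpret rev: veering_coorientation G "\<lambda>t f. \<not> s t f" by (rule reverse)
  show ?thesis using rev.one_inward_face[of e t] assms by (simp add: rev.flat_def flat_def)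
qed

text \<open>Crossing exchanges the flags with a lower face and those with an upper face, so both kinds are
  equally numerous.  A \<open>0\<close>-edge contributes one flag of each kind, a top edge two upper flags and a bottom
  edge two lower flags.\<close>

lemma top_eq_bottom:
  assumes "card e0 = 2"
  shows "card {(t, e) \<in> edge_class G (t0, e0). top_edge t e} =
    card {(t, e) \<in> edge_class G (t0, e0). bottom_edge t e}"
proof -
  let ?E = "edge_class G (t0, e0)"
  have E2: "card e = 2" if "(t, e) \<in> ?E" for t e using edge_class_card_2[OF that assms] .
  have "card {y \<in> flags (t0, e0). s (fst (fst y)) (snd y)} =
      card {y \<in> flags (t0, e0). \<not> s (fst (fst y)) (snd y)}"
    by (rule card_flags_cross) (auto simp: assms cross_def s_across)
  then have F: "(\<Sum>(t, e) \<in> ?E. card {f. f \<notin> e \<and> s t f}) = (\<Sum>(t, e) \<in> ?E. card {f. f \<notin> e \<and> \<not> s t f})"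
    unfolding card_flags by simp
  have L: "card {f. f \<notin> e \<and> s t f} + 2 * of_bool (top_edge t e) =
      card {f. f \<notin> e \<and> \<not> s t f} + 2 * of_bool (bottom_edge t e)" if "(t, e) \<in> ?E" for t e
  proof -
    note e = E2[OF that]
    consider "top_edge t e" | "bottom_edge t e" | "\<not> flat t e"
      using flat_top_bottom(1)[OF e, of t] by blast
    then show ?thesis
    proof cases
      case 1
      then show ?thesis
        using faces_at_flat_edge(1)[OF e 1] flat_top_bottom(2)[OF e, of t] card_Compl_edge[OF e] by simp
    next
      case 2
      then show ?thesis
        using faces_at_flat_edge(2)[OF e 2] flat_top_bottom(2)[OF e, of t] card_Compl_edge[OF e] by simp
    next
      case 3
      then show ?thesis
        using one_inward_face[OF e 3] one_outward_face[OF e 3] flat_top_bottom(1)[OF e, of t] by simp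
    qed
  qed
  have "(\<Sum>(t, e) \<in> ?E. card {f. f \<notin> e \<and> s t f} + 2 * of_bool (top_edge t e)) =
      (\<Sum>(t, e) \<in> ?E. card {f. f \<notin> e \<and> \<not> s t f} + 2 * of_bool (bottom_edge t e))"
    by (rule sum.cong) (use L in auto)
  then have "(\<Sum>(t, e) \<in> ?E. of_bool (top_edge t e)) = (\<Sum>(t, e) \<in> ?E. of_bool (bottom_edge t e) :: nat)"
    using F by (simp add: case_prod_unfold sum.distrib flip: sum_distrib_left)
  then show ?thesis by (simp add: case_prod_unfold Int_def)
qed

lemma one_top:
  assumes "card e0 = 2"
  shows "card {(t, e) \<in> edge_class G (t0, e0). top_edge t e} = 1"
proof -
  let ?E = "edge_class G (t0, e0)"
  have E2: "card e = 2" if "(t, e) \<in> ?E" for t e using edge_class_card_2[OF that assms] .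
  have "{(t, e) \<in> ?E. flat t e} = {(t, e) \<in> ?E. top_edge t e} \<union> {(t, e) \<in> ?E. bottom_edge t e}"
    using flat_top_bottom(1)[OF E2] by auto
  moreover have "{(t, e) \<in> ?E. top_edge t e} \<inter> {(t, e) \<in> ?E. bottom_edge t e} = {}"
    using flat_top_bottom(2)[OF E2] by auto
  ultimately have "card {(t, e) \<in> ?E. flat t e} =
      card {(t, e) \<in> ?E. top_edge t e} + card {(t, e) \<in> ?E. bottom_edge t e}"
    by (simp add: card_Un_disjoint)
  moreover have "card {(t, e) \<in> ?E. flat t e} = 2"
    using two_flat[OF assms, of t0] by (simp add: flat_def)
  ultimately show ?thesis using top_eq_bottom[OF assms, of t0] by simp
qed

text \<open>Crossing maps the lower flags of fan starts onto the upper flags of top edges; it is onto because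
  fans are nonempty.  A fan start has one lower flag and a top edge two upper flags.\<close>

lemma two_fan_starts:
  assumes "card e0 = 2"
  shows "card {(t, e) \<in> edge_class G (t0, e0). fan_start t e} = 2"
proof -
  let ?E = "edge_class G (t0, e0)"
  let ?P = "\<lambda>((t, e), f). \<not> flat t e \<and> s t f \<and> flat (nbr G t f) (perm G t f ` e)"
  let ?Q = "\<lambda>((t, e), f). flat t e \<and> \<not> s t f"
  have E2: "card e = 2" if "(t, e) \<in> ?E" for t e using edge_class_card_2[OF that assms] .
  have "card {y \<in> flags (t0, e0). ?P y} = card {y \<in> flags (t0, e0). ?Q y}"
  proof (rule card_flags_cross)
    show "card (snd (t0, e0)) = 2" using assms by simp
    fix y assume y: "y \<in> flags (t0, e0)"
    obtain t e f where tef: "y = ((t, e), f)" by (metis surj_pair)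
    show "?P y \<Longrightarrow> ?Q (cross y)" by (simp add: tef cross_simp s_across)
    have "card e = 2" "f \<notin> e" using y E2 by (auto simp: tef flags_def)
    moreover have "inv (perm G t f) ` perm G t f ` e = e" by (simp add: image_image)
    ultimately show "?Q y \<Longrightarrow> ?P (cross y)"
      using flat_across_is_nonflat[of e t f] by (simp add: tef cross_simp s_across glue_back)
  qed
  then have F: "(\<Sum>(t, e) \<in> ?E. card {f. f \<notin> e \<and> \<not> flat t e \<and> s t f \<and> flat (nbr G t f) (perm G t f ` e)})
      = (\<Sum>(t, e) \<in> ?E. card {f. f \<notin> e \<and> flat t e \<and> \<not> s t f})"
    unfolding card_flags by simp
  have A: "card {f. f \<notin> e \<and> \<not> flat t e \<and> s t f \<and> flat (nbr G t f) (perm G t f ` e)} =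
      of_bool (fan_start t e)" if "(t, e) \<in> ?E" for t e
  proof (cases "fan_start t e")
    case True
    then have nf: "\<not> flat t e" by (simp add: fan_start_def)
    have "{f. f \<notin> e \<and> \<not> flat t e \<and> s t f \<and> flat (nbr G t f) (perm G t f ` e)} = {f. f \<notin> e \<and> s t f}"
      using fan_start_iff[OF E2[OF that] nf] nf True by blast
    then show ?thesis using one_inward_face[OF E2[OF that] nf] True by simp
  next
    case False
    then have "{f. f \<notin> e \<and> \<not> flat t e \<and> s t f \<and> flat (nbr G t f) (perm G t f ` e)} = {}"
      unfolding fan_start_def by blast
    then show ?thesis using False by (simp only: card.empty of_bool_eq)
  qed
  have B: "card {f. f \<notin> e \<and> flat t e \<and> \<not> s t f} = 2 * of_bool (top_edge t e)"
    if "(t, e) \<in> ?E" for t e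
  proof -
    note e = E2[OF that]
    consider "top_edge t e" | "bottom_edge t e" | "\<not> flat t e"
      using flat_top_bottom(1)[OF e, of t] by blast
    then show ?thesis
    proof cases
      case 1
      then show ?thesis
        using faces_at_flat_edge(1)[OF e 1] flat_top_bottom(1)[OF e, of t] card_Compl_edge[OF e] by simp
    next
      case 2
      then show ?thesis
        using faces_at_flat_edge(2)[OF e 2] flat_top_bottom[OF e, of t] by simp
    next
      case 3
      then show ?thesis using flat_top_bottom(1)[OF e, of t] by simp
    qed
  qed
  have "(\<Sum>(t, e) \<in> ?E. of_bool (fan_start t e)) =
      (\<Sum>(t, e) \<in> ?E. card {f. f \<notin> e \<and> \<not> flat t e \<and> s t f \<and> flat (nbr G t f) (perm G t f ` e)})"
    by (rule sum.cong) (use A in auto)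
  also note F
  also have "(\<Sum>(t, e) \<in> ?E. card {f. f \<notin> e \<and> flat t e \<and> \<not> s t f}) =
      (\<Sum>(t, e) \<in> ?E. 2 * of_bool (top_edge t e))"
    by (rule sum.cong) (use B in auto)
  also have "\<dots> = 2 * (\<Sum>(t, e) \<in> ?E. of_bool (top_edge t e))"
    by (simp add: case_prod_unfold sum_distrib_left)
  finally show ?thesis
    using one_top[OF assms, of t0] by (simp add: case_prod_unfold Int_def)
qed

definition start_angle :: "'t \<Rightarrow> opp_pair \<Rightarrow> real" where
  "start_angle t q = (if \<exists>e. card e = 2 \<and> pair_of e = q \<and> fan_start t e then pi else 0)"

lemma fan_start_Compl:
  assumes "card e = 2"
  shows "fan_start t (- e) \<longleftrightarrow> fan_start t e"
proof -
  obtain a b c d where e: "e = {a, b}" "- e = {c, d}" and d: "distinct [a, b, c, d]"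
    by (rule edge_frame[OF assms(1)])
  show ?thesis using fan_start_opposite[OF d, of t] unfolding e(2) unfolding e(1) by simp
qed

lemma edge_angle_start_angle:
  assumes "card e = 2"
  shows "edge_angle start_angle t e = (if fan_start t e then pi else 0)"
proof -
  have "(\<exists>e'. card e' = 2 \<and> pair_of e' = pair_of e \<and> fan_start t e') \<longleftrightarrow> fan_start t e"
    using pair_of_eq_iff[OF assms] fan_start_Compl[OF assms] assms by metis
  then show ?thesis by (simp add: edge_angle_def start_angle_def)
qed

lemma taut_start_angle: "taut G start_angle"
  unfolding taut_def angle_structure_def
proof (intro conjI allI impI)
  fix t
  have "start_angle t P01_23 = (if fan_start t {V0, V1} then pi else 0)"
    "start_angle t P02_13 = (if fan_start t {V0, V2} then pi else 0)"
    "start_angle t P03_12 = (if fan_start t {V0, V3} then pi else 0)"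
    using edge_angle_start_angle[of "{V0, V1}" t] edge_angle_start_angle[of "{V0, V2}" t]
      edge_angle_start_angle[of "{V0, V3}" t]
    by (simp_all add: edge_angle_def pair_of_def doubleton_eq_iff)
  moreover have "distinct [V0, V1, V2, V3]" by simp
  note fan_start_one_pair[OF this, of t]
  ultimately show "start_angle t P01_23 + start_angle t P02_13 + start_angle t P03_12 = pi"
    by auto
next
  fix t :: 't and e :: "vert set" assume e: "card e = 2"
  let ?E = "edge_class G (t, e)"
  have "(\<Sum>(t', e') \<in> ?E. edge_angle start_angle t' e') =
      (\<Sum>(t', e') \<in> ?E. pi * of_bool (fan_start t' e'))"
    using edge_class_card_2[OF _ e] by (intro sum.cong) (auto simp: edge_angle_start_angle)
  also have "\<dots> = pi * real (card {(t', e') \<in> ?E. fan_start t' e'})"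
    by (simp add: case_prod_unfold Int_def flip: sum_distrib_left)
  finally show "(\<Sum>(t', e') \<in> ?E. edge_angle start_angle t' e') = 2 * pi"
    using two_fan_starts[OF e] by simp
next
  fix t q show "start_angle t q \<in> {0, pi}" by (simp add: start_angle_def)
qed

text \<open>The fan starts for the reversed coorientation are the fan ends.  If starts and ends coincide, the
  property of being a \<open>0\<close>-edge but not a fan start persists when crossing either face at the edge, hence all around
  it, where an angle \<open>\<pi>\<close> has to occur.\<close>

lemma fan_starts_differ:
  "\<exists>t e. card e = 2 \<and> fan_start t e \<noteq> veering_coorientation.fan_start G (\<lambda>t f. \<not> s t f) t e"
proof (rule ccontr)
  interpret rev: veering_coorientation G "\<lambda>t f. \<not> s t f" by (rule reverse)
  have rflat: "rev.flat t e = flat t e" for t e by (simp add: rev.flat_def flat_def)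
  assume "\<not> ?thesis"
  then have same: "rev.fan_start t e = fan_start t e" if "card e = 2" for t e using that by blast
  let ?N = "\<lambda>t e. card e = 2 \<and> \<not> flat t e \<and> \<not> fan_start t e"
  have closed: "?N (nbr G t f) (perm G t f ` e)" if N: "?N t e" and f: "f \<notin> e" for t e f
  proof -
    let ?t = "nbr G t f" and ?e = "perm G t f ` e" and ?f = "perm G t f f"
    have e: "card ?e = 2" "?f \<notin> ?e" using N f by (auto simp: card_perm_image[OF oriented])
    have "inv (perm G t f) ` perm G t f ` e = e" by (simp add: image_image)
    then have return: "\<not> flat (nbr G ?t ?f) (perm G ?t ?f ` ?e)" using N by (simp add: glue_back)
    \<comment> \<open>Below a tetrahedron that is no fan start the fan goes on, and the tetrahedron there is not the
      highest one of the fan; above, the same holds with the directions exchanged.\<close>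
    show ?thesis
    proof (cases "s t f")
      case True
      then have fl: "\<not> flat ?t ?e" using fan_start_iff[of e t f] N f by blast
      have "\<not> rev.fan_start ?t ?e"
        using rev.fan_start_iff[OF e(1) _ e(2), of ?t] fl return True s_across[of t f] rflat by blast
      then show ?thesis using e fl same by blast
    next
      case False
      then have fl: "\<not> flat ?t ?e" using rev.fan_start_iff[of e t f] N f same rflat by blast
      have "\<not> fan_start ?t ?e"
        using fan_start_iff[OF e(1) fl e(2)] return False s_across[of t f] by blast
      then show ?thesis using e fl by blast
    qed
  qed
  obtain t :: 't where True by simp
  \<comment> \<open>Of the three edges at \<open>V0\<close> one has angle \<open>\<pi>\<close>, another one is a fan start, and the third is neither.\<close>
  have d: "distinct [V0, V1, V2, V3]" by simp
  have "\<exists>a \<in> {V1, V2, V3}. ?N t {V0, a}"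
    using two_two[OF d, of t] fan_start_one_pair[OF d, of t] by auto
  then obtain e where e: "?N t e" by blast
  have "?N t' e'" if "(t', e') \<in> edge_class G (t, e)" for t' e'
  proof -
    have "((t, e), (t', e')) \<in> (edge_step G)\<^sup>*" using that by (simp add: edge_class_def)
    then show ?thesis
    proof (induction rule: rtrancl_induct2)
      case refl
      show ?case by (rule e)
    next
      case (step t1 e1 t2 e2)
      then obtain f where "f \<notin> e1" "t2 = nbr G t1 f" "e2 = perm G t1 f ` e1"
        by (auto simp: edge_step_def)
      then show ?case using closed[OF step.IH] by simp
    qed
  qed
  then have empty: "{(t', e') \<in> edge_class G (t, e). flat t' e'} = {}" by auto
  have "card {(t', e') \<in> edge_class G (t, e). flat t' e'} = 2"
    using two_flat[of e t] e unfolding flat_def[symmetric] by blast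
  then show False unfolding empty by simp
qed

end

section \<open>Two exotic taut structures\<close>

theorem proposition6p10:
  fixes G :: "('t::finite) gluing" and \<theta> :: "'t \<Rightarrow> opp_pair \<Rightarrow> real"
  assumes "ideal_triangulation G"
    and "taut G \<theta>"
    and "veering G \<theta>"
    and "transverse_taut G \<theta>"
  shows "\<exists>\<theta>1 \<theta>2. taut G \<theta>1 \<and> taut G \<theta>2 \<and> \<theta>1 \<noteq> \<theta> \<and> \<theta>2 \<noteq> \<theta> \<and> \<theta>1 \<noteq> \<theta>2"
proof -
  from assms(4) obtain s where co: "transverse_orientation G s"
    and s: "\<forall>t. \<exists>e. card e = 2 \<and> edge_angle \<theta> t e = pi \<and>
           (\<forall>f. f \<notin> e \<longrightarrow> s t f) \<and> (\<forall>f. f \<in> e \<longrightarrow> \<not> s t f)"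
    unfolding transverse_taut_def by blast
  have vals: "\<theta> t q = 0 \<or> \<theta> t q = pi" for t q using assms(2) by (auto simp: taut_def)
  \<comment> \<open>The coorientation determines the angles, because each tetrahedron has just one pair of \<open>\<pi>\<close>-edges.\<close>
  have one_pi: "q = q'" if "\<theta> t q = pi" "\<theta> t q' = pi" for t q q'
  proof -
    have "\<theta> t P01_23 + \<theta> t P02_13 + \<theta> t P03_12 = pi"
      using assms(2) by (simp add: taut_def angle_structure_def)
    then show ?thesis
      using that vals[of t P01_23] vals[of t P02_13] vals[of t P03_12]
      by (cases q; cases q') auto
  qed
  define flat_edge where "flat_edge t e \<longleftrightarrow> (\<forall>a\<in>e. \<forall>b\<in>e. s t a = s t b)" for t e
  have angle: "edge_angle \<theta> t e = pi * of_bool (flat_edge t e)"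
    if e: "card e = 2" for t e
  proof -
    from s obtain e0 where e0: "card e0 = 2" "edge_angle \<theta> t e0 = pi"
      and st: "\<And>f. s t f \<longleftrightarrow> f \<notin> e0" by metis
    have sub: "e = A" if "e \<subseteq> A" "card A = 2" for A
      using card_subset_eq[of A e] that e by simp
    obtain a b where "e = {a, b}" using e by (auto simp: card_2_iff)
    then have "flat_edge t e \<longleftrightarrow> e \<subseteq> e0 \<or> e \<subseteq> - e0" by (auto simp: st flat_edge_def)
    also have "\<dots> \<longleftrightarrow> e = e0 \<or> e = - e0"
      using sub[of e0] sub[of "- e0"] e0(1) card_Compl_edge[OF e0(1)] by auto
    also have "\<dots> \<longleftrightarrow> pair_of e0 = pair_of e" using pair_of_eq_iff[OF e0(1) e] by simp
    also have "\<dots> \<longleftrightarrow> edge_angle \<theta> t e = pi"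
      using e0(2) one_pi[of t] unfolding edge_angle_def by metis
    finally show ?thesis using vals[of t "pair_of e"] by (auto simp: edge_angle_def)
  qed
  have corner: "corner_angle \<theta> t v a = (if s t v = s t a then pi else 0)" if "v \<noteq> a" for t v a
    using angle[of "{v, a}" t] that by (auto simp: corner_angle_def flat_edge_def)
  have bal: "card {f. s t f} = 2" for t
  proof -
    from s obtain e0 where e0: "card e0 = 2" and "\<And>f. s t f \<longleftrightarrow> f \<notin> e0" by metis
    then have "{f. s t f} = - e0" by blast
    then show ?thesis using card_Compl_edge[OF e0] by simp
  qed
  have oriented: "oriented_gluing G" using assms(1) by (simp add: ideal_triangulation_def)
  interpret veering_coorientation G s
  proof
    show "oriented_gluing G" by (rule oriented)
    show "transverse_orientation G s" by (rule co)
    show "card {f. s t f} = 2" for t by (rule bal)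
    show "card {(t', e') \<in> edge_class G (t, e). \<forall>a\<in>e'. \<forall>b\<in>e'. s t' a = s t' b} = 2"
      if e: "card e = 2" for t e
    proof -
      let ?E = "edge_class G (t, e)"
      have "2 * pi = (\<Sum>(t', e') \<in> ?E. edge_angle \<theta> t' e')"
        using assms(2) e by (simp add: taut_def angle_structure_def)
      also have "\<dots> = (\<Sum>(t', e') \<in> ?E. pi * of_bool (flat_edge t' e'))"
        using card_edge_class[OF oriented _ e] by (intro sum.cong) (auto simp: angle)
      also have "\<dots> = pi * real (card {(t', e') \<in> ?E. flat_edge t' e'})"
        by (simp add: case_prod_unfold Int_def flip: sum_distrib_left)
      finally show ?thesis by (simp add: flat_edge_def)
    qed
    show "(s t v = s t (ccw v a)) = (s t' v' = s t' (ccw v' a'))"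
      if chain: "((t, v, a), (t', v', a')) \<in> (corner_step G)\<^sup>*" and va: "v \<noteq> a"
        and side: "s t v \<noteq> s t a" and side': "s t' v' \<noteq> s t' a'"
      for t v a t' v' a'
    proof -
      let ?F = "fans G \<theta> (t, v, a)"
      let ?after = "\<lambda>(t, v, a). corner_angle \<theta> t v (ccw v a) = pi"
      let ?before = "\<lambda>(t, v, a). \<exists>b. b \<noteq> v \<and> ccw v b = a \<and> corner_angle \<theta> t v b = pi"
      have va': "v' \<noteq> a'" using side' by auto
      have F: "(t, v, a) \<in> ?F" "(t', v', a') \<in> ?F"
        using chain side side' va va' by (simp_all add: fans_def corner_class_def corner)
      have after: "?after (t, v, a) \<longleftrightarrow> s t v = s t (ccw v a)" if "v \<noteq> a" for t v a
        using ccw_frame(1)[OF that] by (simp add: corner)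
      have before: "s t v \<noteq> s t (ccw v a)"
        if bf: "?before (t, v, a)" and va: "v \<noteq> a" for t v a
      proof
        \<comment> \<open>Otherwise three labels of \<open>t\<close> would carry the same coorientation.\<close>
        assume eq: "s t v = s t (ccw v a)"
        obtain b where b: "b \<noteq> v" "ccw v b = a" "corner_angle \<theta> t v b = pi" using bf by auto
        then have sb: "s t v = s t b" using corner[of v b t] by (simp split: if_splits)
        have "ccw v (ccw v a) = b" using ccw_frame(2)[of v b] b by simp
        then have d: "distinct [v, a, ccw v a, b]" using ccw_frame(1)[OF va] by simp
        define T where "T = {v, ccw v a, b}"
        have T3: "card T = 3" using d by (auto simp: T_def)
        have "T \<subseteq> {f. s t f} \<or> T \<subseteq> - {f. s t f}" using eq sb by (auto simp: T_def)
        then show False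
        proof
          assume "T \<subseteq> {f. s t f}"
          from card_mono[OF _ this] show False using bal[of t] T3 by simp
        next
          assume "T \<subseteq> - {f. s t f}"
          from card_mono[OF _ this] show False using card_Compl_edge[OF bal[of t]] T3 by simp
        qed
      qed
      consider "\<forall>c \<in> ?F. ?before c" | "\<forall>c \<in> ?F. ?after c"
        using assms(3)[unfolded veering_def, THEN conjunct2, THEN spec[of _ t], THEN spec[of _ v],
            THEN spec[of _ a], THEN mp, OF va] by (elim disjE)
      then show ?thesis
      proof cases
        case 1
        from before[OF bspec[OF 1 F(1)] va] before[OF bspec[OF 1 F(2)] va']
        show ?thesis by (simp only:)
      next
        case 2
        from iffD1[OF after[OF va] bspec[OF 2 F(1)]] iffD1[OF after[OF va'] bspec[OF 2 F(2)]]
        show ?thesis by (simp only: simp_thms)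
      qed
    qed
  qed
  interpret rev: veering_coorientation G "\<lambda>t f. \<not> s t f" by (rule reverse)
  obtain t :: 't where True by simp
  obtain e where e: "card e = 2" "edge_angle \<theta> t e = pi" using s by blast
  then have "flat_edge t e" using angle[OF e(1), of t] by (cases "flat_edge t e") simp_all
  then have flat: "flat t e" by (simp only: flat_def flat_edge_def)
  then have rflat: "rev.flat t e" unfolding flat_def rev.flat_def by blast
  from flat have "edge_angle start_angle t e = 0"
    using edge_angle_start_angle[OF e(1), of t] by (simp add: fan_start_def)
  then have 1: "start_angle \<noteq> \<theta>" using e(2) by auto
  have "edge_angle rev.start_angle t e = 0"
    using rev.edge_angle_start_angle[OF e(1), of t] rflat by (simp add: rev.fan_start_def)
  then have 2: "rev.start_angle \<noteq> \<theta>" using e(2) by auto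
  obtain t' e' where e': "card e' = 2" "fan_start t' e' \<noteq> rev.fan_start t' e'"
    using fan_starts_differ by blast
  have 3: "start_angle \<noteq> rev.start_angle"
  proof
    assume "start_angle = rev.start_angle"
    then show False
      using edge_angle_start_angle[OF e'(1), of t'] rev.edge_angle_start_angle[OF e'(1), of t'] e'(2)
      by (auto split: if_splits)
  qed
  show ?thesis using taut_start_angle rev.taut_start_angle 1 2 3 by blast
qed

end
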